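(* Let $G$ be a finite graph whose automorphism group $\mathrm{Aut}(G)$ is isomorphic to the symmetric group $S_n$ and whose distinguishing number is $D(G)=n$. Then one vertex orbit of $\mathrm{Aut}(G)$ has $n$ vertices and induces in $G$ a copy of the complete graph $K_n$ or of its complement $\overline{K_n}$ (the edgeless graph on $n$ vertices), and all other vertex orbits consist of a single vertex.
   Context: For a finite graph $G$, a labelling $\phi:V(G)\to\{1,\dots,k\}$ is distinguishing if the only graph automorphism $\sigma$ of $G$ with $\phi(\sigma(v))=\phi(v)$ for all vertices $v$ is the identity. The distinguishing number $D(G)$ is the minimum $k$ for which such a distinguishing labelling exists. Vertex orbits are the orbits of $\mathrm{Aut}(G)$ acting on $V(G)$.
   Formalization: The clause that all other vertex orbits are single vertices is asserted only for n ≠ 2, since it fails for n = 2 (the path on four vertices has Aut ≅ S_2, D = 2 and two orbits of size 2); n ≥ 1 is assumed, which only excludes the empty graph. *)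

theory Defs
  imports
    "HOL-Algebra.Sym_Groups"
    "HOL-Algebra.Group_Action"
    "Graph_Theory.Pair_Digraph"
    "Graph_Theory.Digraph_Component"
    "Graph_Theory.Kuratowski"
begin

text \<open>
  A finite simple graph is a \<^locale>\<open>pair_graph\<close>: the arc relation is finite, symmetric and
  irreflexive. Automorphisms are taken to be the identity outside the vertex set, the same
  convention as in \<^const>\<open>sym_group\<close>, so that equality of automorphisms is equality of functions.
\<close>

definition graph_aut :: "'a pair_pre_digraph \<Rightarrow> ('a \<Rightarrow> 'a) set" where
  "graph_aut G = {\<sigma>. \<sigma> permutes pverts G \<and>
     (\<forall>u\<in>pverts G. \<forall>v\<in>pverts G. (\<sigma> u, \<sigma> v) \<in> parcs G \<longleftrightarrow> (u, v) \<in> parcs G)}"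

definition aut_group :: "'a pair_pre_digraph \<Rightarrow> ('a \<Rightarrow> 'a) monoid" where
  "aut_group G = \<lparr> carrier = graph_aut G, mult = (\<circ>), one = id \<rparr>"

definition vertex_orbits :: "'a pair_pre_digraph \<Rightarrow> 'a set set" where
  "vertex_orbits G = orbits (aut_group G) (pverts G) (\<lambda>\<sigma>. \<sigma>)"

definition distinguishing_labelling :: "'a pair_pre_digraph \<Rightarrow> nat \<Rightarrow> ('a \<Rightarrow> nat) \<Rightarrow> bool" where
  "distinguishing_labelling G k \<phi> \<longleftrightarrow>
     \<phi> \<in> pverts G \<rightarrow> {1..k} \<and>
     (\<forall>\<sigma>\<in>graph_aut G. (\<forall>v\<in>pverts G. \<phi> (\<sigma> v) = \<phi> v) \<longrightarrow> \<sigma> = id)"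

definition distinguishing_number :: "'a pair_pre_digraph \<Rightarrow> nat" where
  "distinguishing_number G = (LEAST k. \<exists>\<phi>. distinguishing_labelling G k \<phi>)"

definition edgeless_digraph :: "nat \<Rightarrow> ('a, 'b) pre_digraph \<Rightarrow> bool" where
  "edgeless_digraph n H \<longleftrightarrow> graph H \<and> card (verts H) = n \<and> arcs H = {}"

lemma aut_group_is_group: "group (aut_group G)"
proof (rule groupI)
  fix \<sigma> assume "\<sigma> \<in> carrier (aut_group G)"
  then have \<sigma>: "\<sigma> permutes pverts G"
    and pres: "\<And>u v. u \<in> pverts G \<Longrightarrow> v \<in> pverts G \<Longrightarrow>
      (\<sigma> u, \<sigma> v) \<in> parcs G \<longleftrightarrow> (u, v) \<in> parcs G"
    by (auto simp: aut_group_def graph_aut_def)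
  let ?\<tau> = "inv_into UNIV \<sigma>"
  have \<tau>: "?\<tau> permutes pverts G"
    using \<sigma> by (rule permutes_inv)
  have "(?\<tau> u, ?\<tau> v) \<in> parcs G \<longleftrightarrow> (u, v) \<in> parcs G"
    if "u \<in> pverts G" "v \<in> pverts G" for u v
    using pres[of "?\<tau> u" "?\<tau> v"] that \<tau> permutes_inverses(1)[OF \<sigma>]
    by (simp add: permutes_in_image)
  then have "?\<tau> \<in> carrier (aut_group G)"
    using \<tau> by (auto simp: aut_group_def graph_aut_def)
  moreover have "?\<tau> \<otimes>\<^bsub>aut_group G\<^esub> \<sigma> = \<one>\<^bsub>aut_group G\<^esub>"
    using permutes_inv_o(2)[OF \<sigma>] by (simp add: aut_group_def)
  ultimately show "\<exists>\<tau>\<in>carrier (aut_group G). \<tau> \<otimes>\<^bsub>aut_group G\<^esub> \<sigma> = \<one>\<^bsub>aut_group G\<^esub>"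
    by blast
qed (auto simp: aut_group_def graph_aut_def permutes_id permutes_in_image o_assoc
       intro: permutes_compose)

lemma distinguishing_labelling_exists:
  assumes "finite (pverts G)"
  shows "\<exists>\<phi>. distinguishing_labelling G (card (pverts G)) \<phi>"
proof -
  obtain \<phi> where \<phi>: "bij_betw \<phi> (pverts G) {1..card (pverts G)}"
    using assms by (metis card_atLeastAtMost diff_Suc_1 finite_atLeastAtMost
        finite_same_card_bij)
  have "\<sigma> = id" if "\<sigma> permutes pverts G" "\<forall>v\<in>pverts G. \<phi> (\<sigma> v) = \<phi> v" for \<sigma>
  proof
    fix v
    show "\<sigma> v = id v"
      using that \<phi> by (cases "v \<in> pverts G")
        (auto simp: bij_betw_def permutes_in_image permutes_not_in dest: inj_onD)
  qed
  then have "distinguishing_labelling G (card (pverts G)) \<phi>"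
    using \<phi> by (auto simp: distinguishing_labelling_def graph_aut_def bij_betw_def)
  then show ?thesis by blast
qed

end

theory Submission
  imports Defs
begin

text \<open>
  Only the order of the automorphism group matters. Let \<open>\<Gamma>\<close> be a permutation group of order \<open>n!\<close>.
  If all orbits have at most \<open>k\<close> points, labelling each orbit injectively uses \<open>k\<close> labels; and giving
  one point a private label reduces \<open>\<Gamma>\<close> to the stabilizer of that point. Descending through
  stabilizers, a group of order less than \<open>k!\<close> needs fewer than \<open>k\<close> labels. Hence, if \<open>\<Gamma>\<close> needs
  \<open>n\<close> labels, the largest orbit has exactly \<open>n\<close> points, and the same descent shows that \<open>\<Gamma>\<close> acts
  faithfully, so as the full symmetric group, on some orbit \<open>A\<close> of size \<open>n\<close>. If \<open>n \<ge> 3\<close> and a point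
  outside \<open>A\<close> were moved, it would be moved by an element acting on \<open>A\<close> as a transposition; giving
  the two transposed points a common label and marking the moved point saves a label.
\<close>

section \<open>Permutation groups, orbits and stabilizers\<close>

text \<open>Abstracting from graphs lets the induction pass to a stabilizer acting on the remaining
  points, which need not be the automorphism group of the graph induced there.\<close>

locale perm_group =
  fixes \<Gamma> :: "('a \<Rightarrow> 'a) set" and X :: "'a set"
  assumes finite_points: "finite X"
    and permutes_points: "\<sigma> \<in> \<Gamma> \<Longrightarrow> \<sigma> permutes X"
    and id_mem: "id \<in> \<Gamma>"
    and comp_mem: "\<sigma> \<in> \<Gamma> \<Longrightarrow> \<tau> \<in> \<Gamma> \<Longrightarrow> \<sigma> \<circ> \<tau> \<in> \<Gamma>"
    and inv_mem: "\<sigma> \<in> \<Gamma> \<Longrightarrow> inv_into UNIV \<sigma> \<in> \<Gamma>"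

definition orb :: "('a \<Rightarrow> 'a) set \<Rightarrow> 'a \<Rightarrow> 'a set" where
  "orb \<Gamma> x = {\<sigma> x | \<sigma>. \<sigma> \<in> \<Gamma>}"

definition stab :: "('a \<Rightarrow> 'a) set \<Rightarrow> 'a \<Rightarrow> ('a \<Rightarrow> 'a) set" where
  "stab \<Gamma> x = {\<sigma> \<in> \<Gamma>. \<sigma> x = x}"

definition distinguishable :: "('a \<Rightarrow> 'a) set \<Rightarrow> 'a set \<Rightarrow> nat \<Rightarrow> bool" where
  "distinguishable \<Gamma> X k \<longleftrightarrow>
     (\<exists>\<phi> \<in> X \<rightarrow> {1..k}. \<forall>\<sigma>\<in>\<Gamma>. (\<forall>v\<in>X. \<phi> (\<sigma> v) = \<phi> v) \<longrightarrow> \<sigma> = id)"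

text \<open>\<open>A\<close> need not be an orbit of \<open>\<Gamma>\<close> itself; it can also be
  an orbit of a larger group.\<close>

definition faithful_on :: "('a \<Rightarrow> 'a) set \<Rightarrow> 'a set \<Rightarrow> bool" where
  "faithful_on \<Gamma> A \<longleftrightarrow> (\<forall>\<sigma>\<in>\<Gamma>. (\<forall>x\<in>A. \<sigma> x = x) \<longrightarrow> \<sigma> = id)"

lemma orb_eq_image: "orb \<Gamma> x = (\<lambda>\<sigma>. \<sigma> x) ` \<Gamma>"
  by (auto simp: orb_def image_def)

lemma orbI: "\<sigma> \<in> \<Gamma> \<Longrightarrow> \<sigma> x \<in> orb \<Gamma> x"
  unfolding orb_def by blast

lemma orbE:
  assumes "y \<in> orb \<Gamma> x"
  obtains \<sigma> where "\<sigma> \<in> \<Gamma>" "y = \<sigma> x"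
  using assms unfolding orb_def by blast

lemma distinguishableI:
  assumes "\<And>v. v \<in> X \<Longrightarrow> \<phi> v \<in> {1..k}"
    and "\<And>\<sigma>. \<sigma> \<in> \<Gamma> \<Longrightarrow> (\<And>v. v \<in> X \<Longrightarrow> \<phi> (\<sigma> v) = \<phi> v) \<Longrightarrow> \<sigma> = id"
  shows "distinguishable \<Gamma> X k"
  unfolding distinguishable_def using assms by (intro bexI[of _ \<phi>]) auto

lemma faithful_onD:
  assumes "faithful_on \<Gamma> A" "\<sigma> \<in> \<Gamma>" "\<And>x. x \<in> A \<Longrightarrow> \<sigma> x = x"
  shows "\<sigma> = id"
  using assms by (auto simp: faithful_on_def)

context perm_group
begin

lemma finite_group: "finite \<Gamma>"
  by (rule finite_subset[OF _ finite_permutations[OF finite_points]]) (auto simp: permutes_points)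

lemma inj_elem: "\<sigma> \<in> \<Gamma> \<Longrightarrow> \<sigma> x = \<sigma> y \<longleftrightarrow> x = y"
  using permutes_inj[OF permutes_points] by (auto dest: injD)

lemma inv_apply: "\<sigma> \<in> \<Gamma> \<Longrightarrow> inv_into UNIV \<sigma> (\<sigma> x) = x"
  using permutes_inverses(2)[OF permutes_points] by simp

lemma elem_in_points: "\<sigma> \<in> \<Gamma> \<Longrightarrow> \<sigma> x \<in> X \<longleftrightarrow> x \<in> X"
  using permutes_in_image[OF permutes_points] by simp

lemma eq_idI:
  assumes "\<sigma> \<in> \<Gamma>" "\<And>x. x \<in> X \<Longrightarrow> \<sigma> x = x"
  shows "\<sigma> = id"
proof
  fix x
  show "\<sigma> x = id x"
    using assms permutes_not_in[OF permutes_points[OF assms(1)]] by (cases "x \<in> X") auto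
qed

lemma orb_self: "x \<in> orb \<Gamma> x"
  using orbI[OF id_mem] by simp

lemma orb_subset: "x \<in> X \<Longrightarrow> orb \<Gamma> x \<subseteq> X"
  by (auto simp: orb_def elem_in_points)

lemma orb_finite: "finite (orb \<Gamma> x)"
  by (simp add: orb_eq_image finite_group)

lemma orb_apply:
  assumes "\<sigma> \<in> \<Gamma>"
  shows "orb \<Gamma> (\<sigma> x) = orb \<Gamma> x"
proof
  show "orb \<Gamma> (\<sigma> x) \<subseteq> orb \<Gamma> x"
  proof
    fix y assume "y \<in> orb \<Gamma> (\<sigma> x)"
    then obtain \<tau> where "\<tau> \<in> \<Gamma>" "y = \<tau> (\<sigma> x)" by (rule orbE)
    then show "y \<in> orb \<Gamma> x" using orbI[OF comp_mem[OF _ assms], of \<tau> x] by simp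
  qed
  show "orb \<Gamma> x \<subseteq> orb \<Gamma> (\<sigma> x)"
  proof
    fix y assume "y \<in> orb \<Gamma> x"
    then obtain \<tau> where "\<tau> \<in> \<Gamma>" "y = \<tau> x" by (rule orbE)
    then show "y \<in> orb \<Gamma> (\<sigma> x)"
      using orbI[OF comp_mem[OF _ inv_mem[OF assms]], of \<tau> "\<sigma> x"] inv_apply[OF assms, of x]
      by simp
  qed
qed

lemma orb_eq: "y \<in> orb \<Gamma> x \<Longrightarrow> orb \<Gamma> y = orb \<Gamma> x"
  using orb_apply by (metis orbE)

lemma apply_in_orb:
  assumes "\<sigma> \<in> \<Gamma>"
  shows "\<sigma> y \<in> orb \<Gamma> x \<longleftrightarrow> y \<in> orb \<Gamma> x"
  using orb_apply[OF assms, of y] orb_eq orb_self by metis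

text \<open>Dropping \<open>x\<close> from the point set frees it to receive a label of its
  own.\<close>

lemma stab_perm_group: "perm_group (stab \<Gamma> x) (X - {x})"
proof
  fix \<sigma> assume s: "\<sigma> \<in> stab \<Gamma> x"
  then show "\<sigma> permutes X - {x}"
    using permutes_points[of \<sigma>] by (auto simp: stab_def permutes_def)
  show "inv_into UNIV \<sigma> \<in> stab \<Gamma> x"
    using s inv_mem[of \<sigma>] inv_apply[of \<sigma> x] by (auto simp: stab_def)
qed (auto simp: stab_def finite_points id_mem comp_mem)

text \<open>The group is split by the image of \<open>x\<close>; composing with one
  \<open>\<tau>\<close> that sends \<open>x\<close> to \<open>y\<close> identifies the stabilizer
  with the fibre over \<open>y\<close>.\<close>

lemma orbit_stabilizer: "card (orb \<Gamma> x) * card (stab \<Gamma> x) = card \<Gamma>"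
proof -
  have fibre: "card {\<sigma> \<in> \<Gamma>. \<sigma> x = y} = card (stab \<Gamma> x)" if "y \<in> orb \<Gamma> x" for y
  proof -
    obtain \<tau> where \<tau>: "\<tau> \<in> \<Gamma>" "y = \<tau> x" using \<open>y \<in> orb \<Gamma> x\<close> by (rule orbE)
    have "bij_betw (\<lambda>\<sigma>. \<tau> \<circ> \<sigma>) (stab \<Gamma> x) {\<sigma> \<in> \<Gamma>. \<sigma> x = y}"
      by (rule bij_betw_byWitness[where f' = "\<lambda>\<sigma>. inv_into UNIV \<tau> \<circ> \<sigma>"])
        (use \<tau> comp_mem inv_mem inv_apply permutes_inv_o[OF permutes_points[OF \<tau>(1)]]
          in \<open>auto simp: stab_def o_assoc\<close>)
    then show ?thesis by (simp add: bij_betw_same_card)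
  qed
  have "card \<Gamma> = (\<Sum>y\<in>orb \<Gamma> x. card {\<sigma> \<in> \<Gamma>. \<sigma> x = y})"
    unfolding orb_eq_image using sum.image_gen[OF finite_group, of "\<lambda>_. 1::nat" "\<lambda>\<sigma>. \<sigma> x"] by simp
  then show ?thesis using fibre by simp
qed

text \<open>Restriction to \<open>A\<close> is injective by faithfulness, so by counting it reaches
  every permutation of \<open>A\<close>.\<close>

lemma faithful_full:
  assumes A: "A = orb \<Gamma> x" and f: "faithful_on \<Gamma> A" and c: "card \<Gamma> = fact (card A)"
    and p: "p permutes A"
  shows "\<exists>\<sigma>\<in>\<Gamma>. \<forall>y\<in>A. \<sigma> y = p y"
proof -
  \<comment> \<open>Extended by the identity, because \<open>permutes A\<close> demands that outside
    points stay fixed.\<close>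
  let ?r = "\<lambda>\<sigma> y. if y \<in> A then \<sigma> y else y"
  have perm: "?r \<sigma> permutes A" if "\<sigma> \<in> \<Gamma>" for \<sigma>
  proof (rule bij_imp_permutes)
    have "inj_on (?r \<sigma>) A" using inj_elem[OF that] by (auto simp: inj_on_def)
    moreover have "?r \<sigma> ` A \<subseteq> A" using apply_in_orb[OF that] A by auto
    ultimately show "bij_betw (?r \<sigma>) A A"
      using orb_finite A by (metis bij_betw_def endo_inj_surj)
  qed simp
  have "inj_on ?r \<Gamma>"
  proof (rule inj_onI)
    fix \<sigma> \<tau> assume st: "\<sigma> \<in> \<Gamma>" "\<tau> \<in> \<Gamma>" and eq: "?r \<sigma> = ?r \<tau>"
    have "\<sigma> y = \<tau> y" if "y \<in> A" for y using fun_cong[OF eq, of y] that by simp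
    then have "inv_into UNIV \<tau> \<circ> \<sigma> = id"
      using faithful_onD[OF f comp_mem[OF inv_mem[OF st(2)] st(1)]] inv_apply[OF st(2)] by simp
    then have "\<tau> \<circ> (inv_into UNIV \<tau> \<circ> \<sigma>) = \<tau>" by simp
    then show "\<sigma> = \<tau>"
      using permutes_inv_o(1)[OF permutes_points[OF st(2)]] by (simp add: o_assoc)
  qed
  then have "card (?r ` \<Gamma>) = card {p. p permutes A}"
    using c card_permutations[OF refl, of A] orb_finite A by (simp add: card_image)
  moreover have "?r ` \<Gamma> \<subseteq> {p. p permutes A}" using perm by auto
  ultimately have "?r ` \<Gamma> = {p. p permutes A}"
    using card_subset_eq finite_permutations orb_finite A by metis
  then obtain \<sigma> where "\<sigma> \<in> \<Gamma>" "p = ?r \<sigma>" using p by blast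
  then show ?thesis by auto
qed

section \<open>Constructions of distinguishing labellings\<close>

text \<open>Group elements preserve orbits, so the same labels may be reused on every orbit.\<close>

lemma distinguishable_if_orbits_small:
  assumes "\<And>x. x \<in> X \<Longrightarrow> card (orb \<Gamma> x) \<le> k"
  shows "distinguishable \<Gamma> X k"
proof -
  \<comment> \<open>The injection is chosen per orbit, not per point, so that \<open>v\<close> and
    \<open>\<sigma> v\<close> are labelled by the same map.\<close>
  have "\<exists>f. inj_on f B \<and> f ` B \<subseteq> {1..k}" if "B \<in> orb \<Gamma> ` X" for B
    using card_le_inj[of B "{1..k}"] assms orb_finite that by auto
  then obtain f where "\<And>B. B \<in> orb \<Gamma> ` X \<Longrightarrow> inj_on (f B) B \<and> f B ` B \<subseteq> {1..k}"
    by metis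
  then have f: "inj_on (f (orb \<Gamma> x)) (orb \<Gamma> x) \<and> f (orb \<Gamma> x) ` orb \<Gamma> x \<subseteq> {1..k}"
    if "x \<in> X" for x
    using that by blast
  show ?thesis
  proof (rule distinguishableI)
    show "f (orb \<Gamma> v) v \<in> {1..k}" if "v \<in> X" for v using f[OF that] orb_self by blast
    fix \<sigma> assume s: "\<sigma> \<in> \<Gamma>" and p: "\<And>v. v \<in> X \<Longrightarrow> f (orb \<Gamma> (\<sigma> v)) (\<sigma> v) = f (orb \<Gamma> v) v"
    show "\<sigma> = id"
    proof (rule eq_idI[OF s])
      fix v assume v: "v \<in> X"
      have "f (orb \<Gamma> v) (\<sigma> v) = f (orb \<Gamma> v) v" using p[OF v] orb_apply[OF s] by simp
      then show "\<sigma> v = v"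
        using f[OF v] apply_in_orb[OF s] orb_self by (auto dest: inj_onD)
    qed
  qed
qed

text \<open>A fresh label on \<open>x\<close> forces every label-preserving element into the
  stabilizer, where the given labelling takes over.\<close>

lemma distinguishable_Suc:
  assumes x: "x \<in> X" and "distinguishable (stab \<Gamma> x) (X - {x}) k"
  shows "distinguishable \<Gamma> X (Suc k)"
proof -
  obtain \<phi> where \<phi>: "\<phi> \<in> X - {x} \<rightarrow> {1..k}"
    and d: "\<And>\<sigma>. \<sigma> \<in> stab \<Gamma> x \<Longrightarrow> (\<forall>v\<in>X - {x}. \<phi> (\<sigma> v) = \<phi> v) \<Longrightarrow> \<sigma> = id"
    using assms(2) unfolding distinguishable_def by blast
  let ?\<psi> = "\<phi>(x := Suc k)"
  show ?thesis
  proof (rule distinguishableI[where \<phi> = ?\<psi>])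
    show "?\<psi> v \<in> {1..Suc k}" if "v \<in> X" for v using \<phi> that by force
    fix \<sigma> assume s: "\<sigma> \<in> \<Gamma>" and p: "\<And>v. v \<in> X \<Longrightarrow> ?\<psi> (\<sigma> v) = ?\<psi> v"
    have "\<sigma> x = x"
    proof (rule ccontr)
      assume ne: "\<sigma> x \<noteq> x"
      then have "\<phi> (\<sigma> x) = Suc k" using p[OF x] by simp
      moreover have "\<phi> (\<sigma> x) \<in> {1..k}" using \<phi> ne x elem_in_points[OF s] by auto
      ultimately show False by simp
    qed
    moreover have "\<phi> (\<sigma> v) = \<phi> v" if "v \<in> X - {x}" for v
      using p[of v] that inj_elem[OF s, of v x] \<open>\<sigma> x = x\<close> by auto
    ultimately show "\<sigma> = id" using d[of \<sigma>] s by (simp add: stab_def)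
  qed
qed

text \<open>Labels used injectively on the orbit of \<open>y\<close> may be repeated outside it;
  there 2 marks \<open>x\<close> and 1 goes to all other points. A label-preserving element then
  fixes \<open>x\<close> and the whole orbit.\<close>

lemma distinguishable_point_orbit:
  assumes "k \<ge> 2" "card (orb \<Gamma> y) \<le> k" "x \<notin> orb \<Gamma> y" "x \<in> X" "y \<in> X"
    and "faithful_on (stab \<Gamma> x) (orb \<Gamma> y)"
  shows "distinguishable \<Gamma> X k"
proof -
  obtain f where f: "inj_on f (orb \<Gamma> y)" "f ` orb \<Gamma> y \<subseteq> {1..k}"
    using card_le_inj[of "orb \<Gamma> y" "{1..k}"] assms(2) orb_finite by auto
  let ?\<phi> = "\<lambda>v. if v \<in> orb \<Gamma> y then f v else if v = x then 2 else 1"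
  show ?thesis
  proof (rule distinguishableI[where \<phi> = ?\<phi>])
    show "?\<phi> v \<in> {1..k}" for v using f(2) assms(1) by auto
    fix \<sigma> assume s: "\<sigma> \<in> \<Gamma>" and p: "\<And>v. v \<in> X \<Longrightarrow> ?\<phi> (\<sigma> v) = ?\<phi> v"
    have "\<sigma> x = x"
      using p[OF assms(4)] assms(3) apply_in_orb[OF s, of x y] by (auto split: if_splits)
    moreover have "\<sigma> v = v" if "v \<in> orb \<Gamma> y" for v
    proof -
      have "v \<in> X" using that orb_subset[OF assms(5)] by blast
      then show ?thesis using p[of v] that apply_in_orb[OF s, of v y] f(1) by (auto dest: inj_onD)
    qed
    ultimately show "\<sigma> = id" using faithful_onD[OF assms(6), of \<sigma>] s by (simp add: stab_def)
  qed
qed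

text \<open>A label-preserving element acts on \<open>A\<close> trivially or by exchanging
  \<open>a\<close> and \<open>b\<close>. In the second case faithfulness would make it equal to
  \<open>\<tau>\<close>, but it fixes the marked point \<open>y\<close> and \<open>\<tau>\<close>
  does not.\<close>

lemma distinguishable_if_transposition_moves:
  assumes A: "A = orb \<Gamma> x" and f: "faithful_on \<Gamma> A" and cA: "card A = Suc k" and k: "k \<ge> 2"
    and x: "x \<in> X" and y: "y \<in> X" "y \<notin> A"
    and ab: "a \<in> A" "b \<in> A" "a \<noteq> b"
    and \<tau>: "\<tau> \<in> \<Gamma>" "\<And>z. z \<in> A \<Longrightarrow> \<tau> z = transpose a b z" "\<tau> y \<noteq> y"
  shows "distinguishable \<Gamma> X k"
proof -
  have finA: "finite A" using A orb_finite by simp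
  have AX: "A \<subseteq> X" using A orb_subset[OF x] by simp
  have "card (A - {b}) = k" using cA ab(2) finA by simp
  then obtain g where g: "inj_on g (A - {b})" "g ` (A - {b}) \<subseteq> {1..k}"
    using card_le_inj[of "A - {b}" "{1..k}"] finA by auto
  \<comment> \<open>\<open>b\<close> borrows the label of \<open>a\<close>, so \<open>k\<close>
    labels suffice for the \<open>Suc k\<close> points of \<open>A\<close>; outside \<open>A\<close>
    the labels 1 and 2 are reused, which is where \<open>k \<ge> 2\<close> enters.\<close>
  let ?\<phi> = "\<lambda>v. if v \<in> A then g (if v = b then a else v) else if v = y then 2 else 1"
  show ?thesis
  proof (rule distinguishableI[where \<phi> = ?\<phi>])
    show "?\<phi> v \<in> {1..k}" if "v \<in> X" for v using g(2) k ab by auto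
    fix \<sigma> assume s: "\<sigma> \<in> \<Gamma>" and p: "\<And>v. v \<in> X \<Longrightarrow> ?\<phi> (\<sigma> v) = ?\<phi> v"
    have inA: "\<sigma> v \<in> A \<longleftrightarrow> v \<in> A" for v using apply_in_orb[OF s] A by simp
    \<comment> \<open>Injectivity of \<open>g\<close> determines \<open>\<sigma> v\<close> up to
      exchanging \<open>a\<close> and \<open>b\<close>.\<close>
    have fib: "\<sigma> v = v \<or> {\<sigma> v, v} = {a, b}" if v: "v \<in> A" for v
    proof -
      have "g (if \<sigma> v = b then a else \<sigma> v) = g (if v = b then a else v)"
        using p[of v] v AX inA[of v] by auto
      then have "(if \<sigma> v = b then a else \<sigma> v) = (if v = b then a else v)"
        using inj_onD[OF g(1)] v inA[of v] ab by auto
      then show ?thesis by (auto split: if_splits)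
    qed
    have fix_y: "\<sigma> y = y" using p[OF y(1)] y(2) inA[of y] by (auto split: if_splits)
    show "\<sigma> = id"
    proof (cases "\<sigma> a = a")
      case True
      then have "\<sigma> b = b" using fib[OF ab(2)] inj_elem[OF s, of a b] ab(3) by (auto simp: doubleton_eq_iff)
      then have "\<sigma> v = v" if "v \<in> A" for v using fib[OF that] True by (auto simp: doubleton_eq_iff)
      then show ?thesis by (rule faithful_onD[OF f s])
    next
      case False
      then have sa: "\<sigma> a = b" using fib[OF ab(1)] by (auto simp: doubleton_eq_iff)
      then have sb: "\<sigma> b = a" using fib[OF ab(2)] inj_elem[OF s, of a b] ab(3) by (auto simp: doubleton_eq_iff)
      have "\<sigma> v = transpose a b v" if "v \<in> A" for v
        using fib[OF that] sa sb by (auto simp: doubleton_eq_iff transpose_def)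
      then have "(inv_into UNIV \<tau> \<circ> \<sigma>) v = v" if "v \<in> A" for v
        using that \<tau>(2)[OF that] inv_apply[OF \<tau>(1), of v] by simp
      then have "inv_into UNIV \<tau> \<circ> \<sigma> = id"
        by (rule faithful_onD[OF f comp_mem[OF inv_mem[OF \<tau>(1)] s]])
      then have "inv_into UNIV \<tau> y = y" using fix_y by (metis comp_apply id_apply)
      then have "\<tau> y = y" using permutes_inverses(1)[OF permutes_points[OF \<tau>(1)], of y] by simp
      then show ?thesis using \<tau>(3) by simp
    qed
  qed
qed

text \<open>Transpositions generate the permutations of \<open>A\<close>, and an element inducing a
  transposition fixes \<open>y\<close> by the preceding lemma; faithfulness carries this over to all
  of \<open>\<Gamma>\<close>.\<close>

lemma other_points_fixed:
  assumes A: "A = orb \<Gamma> x" and f: "faithful_on \<Gamma> A" and cA: "card A = Suc k" and k: "k \<ge> 2"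
    and c: "card \<Gamma> = fact (Suc k)" and x: "x \<in> X" and y: "y \<in> X" "y \<notin> A"
    and nd: "\<not> distinguishable \<Gamma> X k" and s: "\<sigma> \<in> \<Gamma>"
  shows "\<sigma> y = y"
proof -
  have full: "\<exists>\<sigma>\<in>\<Gamma>. \<forall>z\<in>A. \<sigma> z = p z" if "p permutes A" for p
    using faithful_full[OF A f _ that] c cA by simp
  have finA: "finite A" using A orb_finite by simp
  \<comment> \<open>The claim covers every element inducing \<open>p\<close>, so that the induction
    hypothesis applies to the composite \<open>\<tau> \<circ> \<sigma>\<close>, in which
    \<open>\<tau>\<close> cancels the leading transposition.\<close>
  have main: "\<forall>\<sigma>\<in>\<Gamma>. (\<forall>z\<in>A. \<sigma> z = p z) \<longrightarrow> \<sigma> y = y" if "p permutes A" for p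
    using that finA
  proof (induction rule: permutes_induct)
    case id
    then show ?case using faithful_onD[OF f] by fastforce
  next
    case (swap a b p)
    show ?case
    proof (intro ballI impI)
      fix \<sigma> assume s: "\<sigma> \<in> \<Gamma>" "\<forall>z\<in>A. \<sigma> z = (transpose a b \<circ> p) z"
      obtain \<tau> where t: "\<tau> \<in> \<Gamma>" "\<And>z. z \<in> A \<Longrightarrow> \<tau> z = transpose a b z"
        using full[OF permutes_swap_id[OF swap.hyps(1,2)]] by blast
      have ty: "\<tau> y = y"
        using distinguishable_if_transposition_moves[OF A f cA k x y swap.hyps(1-3) t] nd by blast
      have "(\<tau> \<circ> \<sigma>) z = p z" if z: "z \<in> A" for z
        using s(2) t(2)[of "\<sigma> z"] z apply_in_orb[OF s(1), of z x] A by simp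
      then have "(\<tau> \<circ> \<sigma>) y = y"
        using swap.IH comp_mem[OF t(1) s(1)] by blast
      then show "\<sigma> y = y" using inj_elem[OF t(1), of "\<sigma> y" y] ty by simp
    qed
  qed
  let ?p = "\<lambda>z. if z \<in> A then \<sigma> z else z"
  have "?p permutes A"
  proof (rule bij_imp_permutes)
    have "inj_on ?p A" using inj_elem[OF s] by (auto simp: inj_on_def)
    moreover have "?p ` A \<subseteq> A" using apply_in_orb[OF s] A by auto
    ultimately show "bij_betw ?p A A" using finA by (metis bij_betw_def endo_inj_surj)
  qed simp
  then show ?thesis using main s by fastforce
qed

end

section \<open>Descent through stabilizers\<close>

text \<open>Either every orbit fits into the available labels, or an orbit is so large that the
  stabilizer of its point has order below the next smaller factorial; that point costs one
  label.\<close>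

lemma distinguishable_if_card_less_fact:
  assumes "perm_group \<Gamma> X" "card \<Gamma> < fact (k + 2)"
  shows "distinguishable \<Gamma> X (Suc k)"
  using assms
proof (induction k arbitrary: \<Gamma> X)
  case 0
  then interpret perm_group \<Gamma> X by simp
  have "card \<Gamma> \<le> Suc 0" using 0 by (simp add: numeral_2_eq_2)
  then have "\<sigma> = id" if "\<sigma> \<in> \<Gamma>" for \<sigma>
    using that id_mem card_le_Suc0_iff_eq[OF finite_group] by blast
  then show ?case by (intro distinguishableI[where \<phi> = "\<lambda>_. 1"]) auto
next
  case (Suc k)
  then interpret perm_group \<Gamma> X by simp
  show ?case
  proof (cases "\<forall>x\<in>X. card (orb \<Gamma> x) \<le> Suc (Suc k)")
    case True
    then show ?thesis by (intro distinguishable_if_orbits_small) auto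
  next
    case False
    then obtain x where x: "x \<in> X" "card (orb \<Gamma> x) \<ge> k + 3" by auto
    have "card (stab \<Gamma> x) < fact (k + 2)"
    proof (rule ccontr)
      assume "\<not> ?thesis"
      then have "(k + 3) * fact (k + 2) \<le> card \<Gamma>"
        unfolding orbit_stabilizer[of x, symmetric] using x(2) by (intro mult_mono) auto
      then show False using Suc.prems(2) by (simp add: numeral_eq_Suc)
    qed
    then show ?thesis using Suc.IH[OF stab_perm_group] distinguishable_Suc[OF x(1)] by blast
  qed
qed

text \<open>The extremal case of the same descent: a largest orbit has exactly the critical size, so
  its stabilizer is again extremal and has a faithful orbit by induction. This orbit is then lifted
  to \<open>\<Gamma>\<close>.\<close>

lemma faithful_orbit_exists:
  assumes "perm_group \<Gamma> X" "card \<Gamma> = fact (k + 2)" "\<not> distinguishable \<Gamma> X (Suc k)"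
  shows "\<exists>x\<in>X. card (orb \<Gamma> x) = k + 2 \<and> faithful_on \<Gamma> (orb \<Gamma> x)"
  using assms
proof (induction k arbitrary: \<Gamma> X)
  case 0
  then interpret perm_group \<Gamma> X by simp
  have c2: "card \<Gamma> = 2" using 0 by (simp add: numeral_2_eq_2)
  obtain x where x: "x \<in> X" "card (orb \<Gamma> x) > 1"
    using distinguishable_if_orbits_small[of 1] 0 by force
  have "card (orb \<Gamma> x) dvd 2" using orbit_stabilizer[of x] c2 by (metis dvd_triv_left)
  then have co: "card (orb \<Gamma> x) = 2" using x(2) dvd_imp_le[of "card (orb \<Gamma> x)" 2] by simp
  then have "card (stab \<Gamma> x) = 1" using orbit_stabilizer[of x] c2 by simp
  moreover have "id \<in> stab \<Gamma> x" using id_mem by (simp add: stab_def)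
  ultimately have "stab \<Gamma> x = {id}" by (metis card_1_singletonE singletonD)
  then have "faithful_on \<Gamma> (orb \<Gamma> x)" using orb_self by (auto simp: faithful_on_def stab_def)
  then show ?case using x co by (auto simp: numeral_2_eq_2)
next
  case (Suc k)
  then interpret perm_group \<Gamma> X by simp
  have c: "card \<Gamma> = (k + 3) * fact (k + 2)" using Suc.prems(2) by (simp add: numeral_eq_Suc)
  \<comment> \<open>A larger orbit would push the stabilizer below \<open>fact (k + 2)\<close>, and
    the preceding lemma would save a label.\<close>
  have bound: "card (orb \<Gamma> x) \<le> k + 3" if "x \<in> X" for x
  proof (rule ccontr)
    assume "\<not> ?thesis"
    then have big: "card (orb \<Gamma> x) > k + 3" by simp
    have "card (stab \<Gamma> x) < fact (k + 2)"
    proof (rule ccontr)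
      assume "\<not> ?thesis"
      then have "(k + 4) * fact (k + 2) \<le> card \<Gamma>"
        unfolding orbit_stabilizer[of x, symmetric] using big by (intro mult_mono) auto
      then show False using c by (simp add: algebra_simps)
    qed
    then show False
      using distinguishable_if_card_less_fact[OF stab_perm_group] distinguishable_Suc[OF that]
        Suc.prems(3) by blast
  qed
  obtain x where x: "x \<in> X" "card (orb \<Gamma> x) > Suc (Suc k)"
    using distinguishable_if_orbits_small[of "Suc (Suc k)"] Suc.prems(3) by force
  then have cx: "card (orb \<Gamma> x) = k + 3" using bound[OF x(1)] by simp
  then have cs: "card (stab \<Gamma> x) = fact (k + 2)"
    using orbit_stabilizer[of x] c by simp
  interpret S: perm_group "stab \<Gamma> x" "X - {x}" by (rule stab_perm_group)
  let ?S = "stab \<Gamma> x"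
  obtain y where y: "y \<in> X - {x}" "card (orb ?S y) = k + 2" "faithful_on ?S (orb ?S y)"
    using Suc.IH[OF stab_perm_group cs] distinguishable_Suc[OF x(1)] Suc.prems(3) by blast
  have sub: "orb ?S y \<subseteq> orb \<Gamma> y" by (auto simp: orb_def stab_def)
  have fS: "faithful_on ?S (orb \<Gamma> y)" using y(3) sub by (auto simp: faithful_on_def)
  have "\<exists>z\<in>X. card (orb \<Gamma> z) = k + 3 \<and> faithful_on \<Gamma> (orb \<Gamma> z)"
  \<comment> \<open>If \<open>x\<close> lies in the orbit, fixing the orbit pointwise already puts
    an element into the stabilizer of \<open>x\<close>.\<close>
  proof (cases "x \<in> orb \<Gamma> y")
    case True
    then have "faithful_on \<Gamma> (orb \<Gamma> y)"
      using fS by (auto simp: faithful_on_def stab_def)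
    then show ?thesis using x(1) cx orb_eq[OF True] by (intro bexI[of _ x]) simp_all
  next
    case False
    \<comment> \<open>Otherwise labelling this orbit injectively and marking \<open>x\<close> would
      use only \<open>k + 2\<close> labels.\<close>
    have "\<not> card (orb \<Gamma> y) \<le> k + 2"
      using distinguishable_point_orbit[of "k + 2" y x] False x(1) y(1) fS Suc.prems(3) by auto
    then have cy: "card (orb \<Gamma> y) = k + 3" using bound[of y] y(1) by simp
    have "card (orb \<Gamma> y - orb ?S y) = 1"
      using cy y(2) sub S.orb_finite by (simp add: card_Diff_subset)
    \<comment> \<open>The stabilizer of \<open>x\<close> preserves both orbits of \<open>y\<close>,
      hence fixes the single leftover point \<open>z\<close>. Equal orders then give
      \<open>stab \<Gamma> x = stab \<Gamma> z\<close>, so \<open>z\<close>, which lies in the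
      orbit, can take over the role of \<open>x\<close>.\<close>
    then obtain z where z: "orb \<Gamma> y - orb ?S y = {z}" by (rule card_1_singletonE)
    have zo: "orb \<Gamma> z = orb \<Gamma> y" using z orb_eq by blast
    have zX: "z \<in> X" using z orb_subset[of y] y(1) by blast
    have "?S \<subseteq> stab \<Gamma> z"
    proof
      fix \<sigma> assume s: "\<sigma> \<in> ?S"
      then have sg: "\<sigma> \<in> \<Gamma>" by (simp add: stab_def)
      have "\<sigma> z \<in> orb \<Gamma> y - orb ?S y"
        using S.apply_in_orb[OF s, of z y] apply_in_orb[OF sg, of z y] z by blast
      then have "\<sigma> z = z" unfolding z by simp
      then show "\<sigma> \<in> stab \<Gamma> z" using sg by (simp add: stab_def)
    qed
    moreover have "card (stab \<Gamma> z) = card ?S"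
      using orbit_stabilizer[of z] zo cy c cs by simp
    moreover have "finite (stab \<Gamma> z)" using finite_group by (simp add: stab_def)
    ultimately have eq: "?S = stab \<Gamma> z" by (simp add: card_subset_eq)
    have "faithful_on \<Gamma> (orb \<Gamma> z)"
      using fS orb_self[of z] unfolding eq zo by (auto simp: faithful_on_def stab_def)
    then show ?thesis using zX zo cy by (intro bexI[of _ z]) simp_all
  qed
  then show ?case by (simp add: numeral_3_eq_3)
qed

section \<open>Return to graphs\<close>

lemma graph_aut_perm_group:
  assumes "pair_graph G"
  shows "perm_group (graph_aut G) (pverts G)"
proof -
  interpret A: group "aut_group G" by (rule aut_group_is_group)
  interpret pair_graph G by fact
  show ?thesis
  proof
    fix \<sigma> assume s: "\<sigma> \<in> graph_aut G"
    show p: "\<sigma> permutes pverts G" using s by (simp add: graph_aut_def)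
    \<comment> \<open>The group structure yields only some left inverse; since
      \<open>\<sigma>\<close> is a bijection, it is the inverse function.\<close>
    obtain \<tau> where t: "\<tau> \<in> graph_aut G" "\<tau> \<circ> \<sigma> = id"
      using A.l_inv_ex[of \<sigma>] s by (auto simp: aut_group_def)
    then have "\<tau> = inv_into UNIV \<sigma>"
      using permutes_inv_o(1)[OF p] by (metis comp_id id_comp o_assoc)
    then show "inv_into UNIV \<sigma> \<in> graph_aut G" using t by simp
  next
    show "id \<in> graph_aut G" using A.one_closed by (simp add: aut_group_def)
    show "\<sigma> \<circ> \<tau> \<in> graph_aut G" if "\<sigma> \<in> graph_aut G" "\<tau> \<in> graph_aut G" for \<sigma> \<tau>
      using A.m_closed that by (simp add: aut_group_def)
  qed (simp add: pair_finite_verts)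
qed

lemma vertex_orbits_eq: "vertex_orbits G = orb (graph_aut G) ` pverts G"
  by (auto simp: vertex_orbits_def orbits_def Group_Action.orbit_def orb_def aut_group_def)

lemma (in pair_graph) graph_induce_subgraph:
  assumes "A \<subseteq> pverts G"
  shows "graph (with_proj G \<restriction> A)"
proof
  show "symmetric (with_proj G \<restriction> A)"
    using pair_sym_arcs unfolding symmetric_conv by fastforce
qed (use assms pair_no_loops finite_subset[OF assms pair_finite_verts] pair_finite_arcs
      in \<open>auto simp: arc_to_ends_def\<close>)

text \<open>Automorphisms carry any ordered pair of distinct points of \<open>A\<close> to any
  other, so a single edge inside \<open>A\<close> forces all of them.\<close>

lemma (in pair_graph) complete_or_edgeless:
  assumes A: "A \<subseteq> pverts G" "card A = n"
    and full: "\<And>p. p permutes A \<Longrightarrow> \<exists>\<sigma>\<in>graph_aut G. \<forall>z\<in>A. \<sigma> z = p z"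
  shows "complete_digraph n (with_proj G \<restriction> A) \<or> edgeless_digraph n (with_proj G \<restriction> A)"
proof (cases "\<exists>u\<in>A. \<exists>v\<in>A. (u, v) \<in> parcs G")
  case False
  then show ?thesis
    using graph_induce_subgraph[OF A(1)] A(2) by (auto simp: edgeless_digraph_def)
next
  case True
  then obtain u v where uv: "u \<in> A" "v \<in> A" "(u, v) \<in> parcs G" by blast
  then have "u \<noteq> v" using pair_no_loops by fastforce
  have "(a, b) \<in> parcs G" if ab: "a \<in> A" "b \<in> A" "a \<noteq> b" for a b
  proof -
    let ?q = "transpose u a"
    \<comment> \<open>\<open>?q\<close> sends \<open>u\<close> to \<open>a\<close>; the second
      transposition sends the image of \<open>v\<close> to \<open>b\<close> and leaves
      \<open>a\<close> alone.\<close>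
    let ?p = "transpose (?q v) b \<circ> ?q"
    have qv: "?q v \<in> A" "?q v \<noteq> a"
      using uv(1,2) ab(1) \<open>u \<noteq> v\<close> by (auto simp: transpose_def)
    have "?p permutes A"
      using permutes_compose[OF permutes_swap_id[OF uv(1) ab(1)] permutes_swap_id[OF qv(1) ab(2)]] .
    then obtain \<sigma> where s: "\<sigma> \<in> graph_aut G" "\<forall>z\<in>A. \<sigma> z = ?p z" using full by blast
    have "\<sigma> u = transpose (?q v) b a" using s(2) uv(1) by simp
    also have "\<dots> = a" using qv(2) ab(3) by (intro transpose_apply_other) auto
    finally have "\<sigma> u = a" .
    moreover have "\<sigma> v = b" using s(2) uv(2) by simp
    ultimately show ?thesis using s(1) uv A(1) unfolding graph_aut_def by blast
  qed
  then have "arcs_ends (with_proj G \<restriction> A) = {(u, v). (u, v) \<in> A \<times> A \<and> u \<noteq> v}"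
    using pair_no_loops by (fastforce simp: arcs_ends_conv)
  then show ?thesis
    using graph_induce_subgraph[OF A(1)] A(2) by (auto simp: complete_digraph_def)
qed

text \<open>For \<open>n = 2\<close> other orbits can be nontrivial: the path on four vertices has
  automorphism group of order 2, distinguishing number 2 and two orbits of size 2. The bound
  \<open>n \<ge> 1\<close> excludes the empty graph, which has no orbit at all.\<close>

theorem theorem4p2:
  fixes G :: "'a pair_pre_digraph" and n :: nat
  assumes "pair_graph G"
    and "n \<ge> 1"
    and "aut_group G \<cong> sym_group n"
    and "distinguishing_number G = n"
  shows "\<exists>A\<in>vertex_orbits G.
           card A = n \<and>
           (complete_digraph n (with_proj G \<restriction> A) \<or> edgeless_digraph n (with_proj G \<restriction> A)) \<and>
           (n \<noteq> 2 \<longrightarrow> (\<forall>B\<in>vertex_orbits G. B \<noteq> A \<longrightarrow> card B = 1))"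
proof -
  interpret pair_graph G by fact
  let ?\<Gamma> = "graph_aut G"
  interpret P: perm_group ?\<Gamma> "pverts G" by (rule graph_aut_perm_group) fact
  have c: "card ?\<Gamma> = fact n"
    using iso_same_card[OF assms(3)] by (simp add: sym_group_card_carrier aut_group_def)
  have nd: "\<not> distinguishable ?\<Gamma> (pverts G) (n - 1)"
  proof
    assume "distinguishable ?\<Gamma> (pverts G) (n - 1)"
    then have "\<exists>\<phi>. distinguishing_labelling G (n - 1) \<phi>"
      unfolding distinguishable_def distinguishing_labelling_def by blast
    then have "distinguishing_number G \<le> n - 1"
      unfolding distinguishing_number_def by (rule Least_le)
    then show False using assms(2,4) by simp
  qed
  have "\<exists>x\<in>pverts G. card (orb ?\<Gamma> x) = n \<and> faithful_on ?\<Gamma> (orb ?\<Gamma> x) \<and>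
          (n \<noteq> 2 \<longrightarrow> (\<forall>y\<in>pverts G. y \<notin> orb ?\<Gamma> x \<longrightarrow> (\<forall>\<sigma>\<in>?\<Gamma>. \<sigma> y = y)))"
  \<comment> \<open>The descent starts at order 2, so the trivial group is treated apart. There any
    vertex serves, and one exists because an empty graph would need no labels.\<close>
  proof (cases "n = 1")
    case True
    then have triv: "?\<Gamma> = {id}" using c P.id_mem by (metis card_1_singletonE fact_1 singletonD)
    have "pverts G \<noteq> {}"
    proof
      assume "pverts G = {}"
      then have "distinguishable ?\<Gamma> (pverts G) (n - 1)"
        using triv by (simp add: distinguishable_def)
      then show False using nd by simp
    qed
    then show ?thesis using triv True by (auto simp: orb_def faithful_on_def)
  next
    case False
    then obtain k where k: "n = k + 2" using assms(2) le_Suc_ex[of 2 n] by auto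
    obtain x where x: "x \<in> pverts G" "card (orb ?\<Gamma> x) = n" "faithful_on ?\<Gamma> (orb ?\<Gamma> x)"
      using faithful_orbit_exists[OF P.perm_group_axioms, of k] c nd k by auto
    moreover have "\<sigma> y = y" if "n \<noteq> 2" "y \<in> pverts G" "y \<notin> orb ?\<Gamma> x" "\<sigma> \<in> ?\<Gamma>" for \<sigma> y
      \<comment> \<open>With \<open>Suc k\<close> as the number of labels, the requirement
        \<open>Suc k \<ge> 2\<close> is exactly \<open>n \<noteq> 2\<close>.\<close>
      using P.other_points_fixed[OF refl x(3), of "Suc k"] x(1,2) k c nd that by auto
    ultimately show ?thesis by blast
  qed
  then obtain x where x: "x \<in> pverts G" "card (orb ?\<Gamma> x) = n" "faithful_on ?\<Gamma> (orb ?\<Gamma> x)"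
    and rest: "\<And>y \<sigma>. n \<noteq> 2 \<Longrightarrow> y \<in> pverts G \<Longrightarrow> y \<notin> orb ?\<Gamma> x \<Longrightarrow> \<sigma> \<in> ?\<Gamma> \<Longrightarrow> \<sigma> y = y"
    by blast
  let ?A = "orb ?\<Gamma> x"
  have "complete_digraph n (with_proj G \<restriction> ?A) \<or> edgeless_digraph n (with_proj G \<restriction> ?A)"
    using complete_or_edgeless[OF P.orb_subset[OF x(1)] x(2)] P.faithful_full[OF refl x(3)] c x(2)
    by simp
  moreover have "card B = 1" if "n \<noteq> 2" "B \<in> vertex_orbits G" "B \<noteq> ?A" for B
  proof -
    obtain y where y: "y \<in> pverts G" "B = orb ?\<Gamma> y" using \<open>B \<in> vertex_orbits G\<close> by (auto simp: vertex_orbits_eq)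
    have "y \<notin> ?A" using y that(3) P.orb_eq by blast
    then have "B = {y}" using rest[OF that(1) y(1)] y(2) P.orb_self[of y] by (auto simp: orb_def)
    then show ?thesis by simp
  qed
  ultimately show ?thesis
    using x(1,2) by (intro bexI[of _ ?A]) (auto simp: vertex_orbits_eq)
qed

end
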